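(* Let $(E_1,d_1)$ and $(E_2,d_2)$ be Polish spaces with Borel $\sigma$-algebras $\mathcal{E}_1,\mathcal{E}_2$, and let $(X_n)$ and $(Y_n)$ be sequences of random elements of $E_1$ and $E_2$ respectively, all defined on one probability space. If $(X_n),(Y_n)$ satisfy condition AI-2, then they satisfy condition AI-0.
   Context: $d_1,d_2$ are complete separable metrics. $P_\xi$ denotes the distribution of a random element $\xi$; $(X_n,Y_n)$ is regarded as a random element of $(E_1\times E_2,\mathcal{E}_1\times\mathcal{E}_2)$. AI-0: for all bounded uniformly continuous functions $f:E_1\to\mathbb{R}$, $g:E_2\to\mathbb{R}$, $\mathbb{E}f(X_n)g(Y_n)-\mathbb{E}f(X_n)\,\mathbb{E}g(Y_n)\to 0$ as $n\to+\infty$. AI-2: for all $A\in\mathcal{E}_1$, $B\in\mathcal{E}_2$, $|P_{(X_n,Y_n)}(A\times B)-P_{X_n}(A)P_{Y_n}(B)|\to 0$ as $n\to+\infty$. *)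

theory Defs
  imports "HOL-Probability.Probability"
begin

definition AI0 ::
  "'w measure \<Rightarrow> (nat \<Rightarrow> 'w \<Rightarrow> 'a::polish_space) \<Rightarrow> (nat \<Rightarrow> 'w \<Rightarrow> 'b::polish_space) \<Rightarrow> bool"
where
  "AI0 M X Y \<longleftrightarrow>
    (\<forall>(f :: 'a \<Rightarrow> real) (g :: 'b \<Rightarrow> real).
      bounded (range f) \<longrightarrow> uniformly_continuous_on UNIV f \<longrightarrow>
      bounded (range g) \<longrightarrow> uniformly_continuous_on UNIV g \<longrightarrow>
      (\<lambda>n. (\<integral>\<omega>. f (X n \<omega>) * g (Y n \<omega>) \<partial>M)
            - (\<integral>\<omega>. f (X n \<omega>) \<partial>M) * (\<integral>\<omega>. g (Y n \<omega>) \<partial>M)) \<longlonglongrightarrow> 0)"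

definition AI2 ::
  "'w measure \<Rightarrow> (nat \<Rightarrow> 'w \<Rightarrow> 'a::polish_space) \<Rightarrow> (nat \<Rightarrow> 'w \<Rightarrow> 'b::polish_space) \<Rightarrow> bool"
where
  "AI2 M X Y \<longleftrightarrow>
    (\<forall>A\<in>sets borel. \<forall>B\<in>sets borel.
      (\<lambda>n. \<bar>measure (distr M (borel \<Otimes>\<^sub>M borel) (\<lambda>\<omega>. (X n \<omega>, Y n \<omega>))) (A \<times> B)
            - measure (distr M borel (X n)) A * measure (distr M borel (Y n)) B\<bar>) \<longlonglongrightarrow> 0)"

end

theory Submission imports Defs begin

text \<open>
  Condition AI-2 says that the covariances of the indicators of \<open>X\<^sub>n \<in> A\<close> and \<open>Y\<^sub>n \<in> B\<close>
  tend to 0, and the conclusion holds even for all bounded Borel functions \<open>f\<close>, \<open>g\<close>: these are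
  uniform limits of linear combinations of finitely many indicators, and the covariance is
  bilinear and, for bounded arguments, continuous in the uniform norm.  Both approximations are
  instances of one linear statement, lemma \<open>bounded_measurable_integral_tendsto_zero\<close>: writing
  the covariance as the integral of \<open>f (X\<^sub>n)\<close> against \<open>V\<^sub>n - E V\<^sub>n\<close>, it suffices to treat
  indicators in place of \<open>f\<close>.  This is applied to \<open>f\<close> with \<open>V\<^sub>n\<close> the indicator of
  \<open>Y\<^sub>n \<in> B\<close>, and then, with the roles exchanged, to \<open>g\<close> with \<open>V\<^sub>n = f (X\<^sub>n)\<close>.
\<close>

lemma bounded_measurable_integral_tendsto_zero:
  fixes f :: "'c \<Rightarrow> real" and h :: "nat \<Rightarrow> 'w \<Rightarrow> real"
  assumes "prob_space M"
    and X [measurable]: "\<And>n. X n \<in> measurable M N"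
    and h [measurable]: "\<And>n. h n \<in> borel_measurable M"
    and hK: "\<And>n \<omega>. \<bar>h n \<omega>\<bar> \<le> K"
    and ind: "\<And>A. A \<in> sets N \<Longrightarrow> (\<lambda>n. \<integral>\<omega>. indicator A (X n \<omega>) * h n \<omega> \<partial>M) \<longlonglongrightarrow> 0"
    and f [measurable]: "f \<in> borel_measurable N"
    and fL: "\<And>x. \<bar>f x\<bar> \<le> L"
  shows "(\<lambda>n. \<integral>\<omega>. f (X n \<omega>) * h n \<omega> \<partial>M) \<longlonglongrightarrow> 0"
proof (rule LIMSEQ_I)
  interpret prob_space M by fact
  fix e :: real assume e: "e > 0"
  have K0: "K \<ge> 0" using hK[of undefined undefined] by linarith
  define d where "d = e / (2 * (K + 1))"
  have d: "d > 0" using e K0 by (simp add: d_def)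
  have dK: "d * K < e / 2" using e K0 by (simp add: d_def field_simps)
  \<comment> \<open>Rounding \<open>f\<close> down to the grid of mesh \<open>d\<close> leaves finitely many values, as \<open>f\<close> is bounded.\<close>
  define I where "I = {\<lfloor>- L / d\<rfloor>..\<lfloor>L / d\<rfloor>}"
  define A where "A i = {x \<in> space N. \<lfloor>f x / d\<rfloor> = i}" for i
  define s where "s x = (\<Sum>i\<in>I. d * of_int i * indicator (A i) x)" for x
  have A [measurable]: "A i \<in> sets N" for i unfolding A_def by measurable
  have s [measurable]: "s \<in> borel_measurable N" unfolding s_def by measurable
  have s_eq: "s x = d * of_int \<lfloor>f x / d\<rfloor>" if x: "x \<in> space N" for x
  proof -
    have "- L / d \<le> f x / d" "f x / d \<le> L / d"
      using fL[of x] d by (intro divide_right_mono; linarith)+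
    then have "\<lfloor>f x / d\<rfloor> \<in> I"
      unfolding I_def by (simp only: atLeastAtMost_iff floor_mono)
    moreover have "s x = (\<Sum>i\<in>I. if i = \<lfloor>f x / d\<rfloor> then d * of_int i else 0)"
      unfolding s_def A_def using x by (intro sum.cong) (auto simp: indicator_def)
    ultimately show ?thesis by (simp add: I_def)
  qed
  have close: "\<bar>f x - s x\<bar> \<le> d" if "x \<in> space N" for x
  proof -
    have "of_int \<lfloor>f x / d\<rfloor> \<le> f x / d" "f x / d \<le> of_int \<lfloor>f x / d\<rfloor> + 1" by linarith+
    then have "d * of_int \<lfloor>f x / d\<rfloor> \<le> f x" "f x \<le> d * of_int \<lfloor>f x / d\<rfloor> + d"
      using d by (simp_all only: le_divide_eq divide_le_eq distrib_left distrib_right mult.commute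
          mult_1_right mult_1_left if_True)
    then show ?thesis using s_eq[OF that] by simp
  qed
  have sp: "X n \<omega> \<in> space N" if "\<omega> \<in> space M" for n \<omega>
    using measurable_space[OF X that] .
  have int_ind: "integrable M (\<lambda>\<omega>. indicator (A i) (X n \<omega>) * h n \<omega>)" for i n
    by (rule integrable_const_bound[where B=K]) (use hK K0 in \<open>auto simp: indicator_def\<close>)
  have int_f: "integrable M (\<lambda>\<omega>. f (X n \<omega>) * h n \<omega>)" for n
  proof (rule integrable_const_bound[where B="L * K"])
    show "AE \<omega> in M. norm (f (X n \<omega>) * h n \<omega>) \<le> L * K"
      using fL[of undefined] by (auto simp: abs_mult intro!: AE_I2 mult_mono fL hK)
  qed simp
  have s_mult: "s x * c = (\<Sum>i\<in>I. (d * of_int i) * (indicator (A i) x * c))" for x c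
    by (simp add: s_def sum_distrib_right mult.assoc)
  have int_s: "integrable M (\<lambda>\<omega>. s (X n \<omega>) * h n \<omega>)" for n
    unfolding s_mult by (intro Bochner_Integration.integrable_sum integrable_mult_right int_ind)
  have "(\<lambda>n. \<Sum>i\<in>I. (d * of_int i) * (\<integral>\<omega>. indicator (A i) (X n \<omega>) * h n \<omega> \<partial>M)) \<longlonglongrightarrow> 0"
    by (intro tendsto_null_sum tendsto_mult_right_zero ind A)
  moreover have "(\<integral>\<omega>. s (X n \<omega>) * h n \<omega> \<partial>M) =
      (\<Sum>i\<in>I. (d * of_int i) * (\<integral>\<omega>. indicator (A i) (X n \<omega>) * h n \<omega> \<partial>M))" for n
    unfolding s_mult using int_ind by (subst Bochner_Integration.integral_sum) auto
  ultimately have "(\<lambda>n. \<integral>\<omega>. s (X n \<omega>) * h n \<omega> \<partial>M) \<longlonglongrightarrow> 0" by simp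
  from LIMSEQ_D[OF this, of "e / 2"] e obtain n0
    where n0: "\<And>n. n \<ge> n0 \<Longrightarrow> \<bar>\<integral>\<omega>. s (X n \<omega>) * h n \<omega> \<partial>M\<bar> < e / 2" by auto
  have diff: "\<bar>(\<integral>\<omega>. f (X n \<omega>) * h n \<omega> \<partial>M) - (\<integral>\<omega>. s (X n \<omega>) * h n \<omega> \<partial>M)\<bar> \<le> d * K" for n
  proof -
    have "\<bar>\<integral>\<omega>. f (X n \<omega>) * h n \<omega> - s (X n \<omega>) * h n \<omega> \<partial>M\<bar>
        \<le> (\<integral>\<omega>. \<bar>f (X n \<omega>) * h n \<omega> - s (X n \<omega>) * h n \<omega>\<bar> \<partial>M)"
      by (rule integral_abs_bound)
    also have "\<dots> \<le> d * K"
    proof (rule integral_le_const)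
      show "integrable M (\<lambda>\<omega>. \<bar>f (X n \<omega>) * h n \<omega> - s (X n \<omega>) * h n \<omega>\<bar>)"
        using int_f int_s by auto
      show "AE \<omega> in M. \<bar>f (X n \<omega>) * h n \<omega> - s (X n \<omega>) * h n \<omega>\<bar> \<le> d * K"
      proof (rule AE_I2)
        fix \<omega> assume "\<omega> \<in> space M"
        then show "\<bar>f (X n \<omega>) * h n \<omega> - s (X n \<omega>) * h n \<omega>\<bar> \<le> d * K"
          unfolding left_diff_distrib[symmetric] abs_mult
          using d by (intro mult_mono close sp hK) auto
      qed
    qed
    finally show ?thesis using int_f int_s by simp
  qed
  have "norm ((\<integral>\<omega>. f (X n \<omega>) * h n \<omega> \<partial>M) - 0) < e" if "n \<ge> n0" for n
    using n0[OF that] diff[of n] dK by simp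
  then show "\<exists>n0. \<forall>n\<ge>n0. norm ((\<integral>\<omega>. f (X n \<omega>) * h n \<omega> \<partial>M) - 0) < e" by blast
qed

text \<open>Centring the second factor turns a covariance into an integral linear in the first factor.\<close>

lemma (in prob_space) covariance_eq_integral_centred:
  fixes U V :: "'a \<Rightarrow> real"
  assumes "integrable M U" "integrable M (\<lambda>\<omega>. U \<omega> * V \<omega>)"
  shows "(\<integral>\<omega>. U \<omega> * (V \<omega> - expectation V) \<partial>M)
    = (\<integral>\<omega>. U \<omega> * V \<omega> \<partial>M) - expectation U * expectation V"
  using assms by (simp add: right_diff_distrib)

text \<open>
  The approximation step for covariances: in the first factor of an asymptotically vanishing
  covariance, indicators may be replaced by bounded measurable functions.
\<close>

lemma covariance_tendsto_zero:
  fixes f :: "'c \<Rightarrow> real" and V :: "nat \<Rightarrow> 'w \<Rightarrow> real"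
  assumes "prob_space M"
    and X [measurable]: "\<And>n. X n \<in> measurable M N"
    and V [measurable]: "\<And>n. V n \<in> borel_measurable M"
    and VK: "\<And>n \<omega>. \<bar>V n \<omega>\<bar> \<le> K"
    and ind: "\<And>A. A \<in> sets N \<Longrightarrow>
      (\<lambda>n. (\<integral>\<omega>. indicator A (X n \<omega>) * V n \<omega> \<partial>M)
        - (\<integral>\<omega>. indicator A (X n \<omega>) \<partial>M) * (\<integral>\<omega>. V n \<omega> \<partial>M)) \<longlonglongrightarrow> 0"
    and f [measurable]: "f \<in> borel_measurable N"
    and fL: "\<And>x. \<bar>f x\<bar> \<le> L"
  shows "(\<lambda>n. (\<integral>\<omega>. f (X n \<omega>) * V n \<omega> \<partial>M)
    - (\<integral>\<omega>. f (X n \<omega>) \<partial>M) * (\<integral>\<omega>. V n \<omega> \<partial>M)) \<longlonglongrightarrow> 0"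
proof -
  interpret prob_space M by fact
  have cov: "(\<integral>\<omega>. u (X n \<omega>) * (V n \<omega> - expectation (V n)) \<partial>M)
      = (\<integral>\<omega>. u (X n \<omega>) * V n \<omega> \<partial>M) - (\<integral>\<omega>. u (X n \<omega>) \<partial>M) * expectation (V n)"
    if [measurable]: "u \<in> borel_measurable N" and u: "\<And>x. \<bar>u x\<bar> \<le> C"
    for u :: "'c \<Rightarrow> real" and C n
  proof (rule covariance_eq_integral_centred)
    show "integrable M (\<lambda>\<omega>. u (X n \<omega>))"
      by (rule integrable_const_bound[where B=C]) (use u in auto)
    have "0 \<le> C" using u[of undefined] by linarith
    then show "integrable M (\<lambda>\<omega>. u (X n \<omega>) * V n \<omega>)"
      by (intro integrable_const_bound[where B="C * K"])
        (auto simp: abs_mult intro!: AE_I2 mult_mono u VK)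
  qed
  have V_int: "integrable M (V n)" for n
    by (rule integrable_const_bound[where B=K]) (use VK in auto)
  have EK: "\<bar>expectation (V n)\<bar> \<le> K" for n
  proof -
    have "\<bar>expectation (V n)\<bar> \<le> (\<integral>\<omega>. \<bar>V n \<omega>\<bar> \<partial>M)" by (rule integral_abs_bound)
    also have "\<dots> \<le> K" using V_int VK by (intro integral_le_const) auto
    finally show ?thesis .
  qed
  have "(\<lambda>n. \<integral>\<omega>. f (X n \<omega>) * (V n \<omega> - expectation (V n)) \<partial>M) \<longlonglongrightarrow> 0"
  proof (rule bounded_measurable_integral_tendsto_zero[OF prob_space_axioms X _ _ _ f fL])
    show "(\<lambda>\<omega>. V n \<omega> - expectation (V n)) \<in> borel_measurable M" for n by measurable
    show "\<bar>V n \<omega> - expectation (V n)\<bar> \<le> 2 * K" for n \<omega>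
      using VK[of n \<omega>] EK[of n] by linarith
    show "(\<lambda>n. \<integral>\<omega>. indicator A (X n \<omega>) * (V n \<omega> - expectation (V n)) \<partial>M) \<longlonglongrightarrow> 0"
      if [measurable]: "A \<in> sets N" for A
      using ind[OF that] by (subst cov[of "indicator A" 1]) (auto simp: indicator_def)
  qed
  then show ?thesis by (simp only: cov[OF f fL])
qed

lemma AI2_indicator_covariance:
  assumes "prob_space M"
    and [measurable]: "\<And>n. X n \<in> measurable M borel" "\<And>n. Y n \<in> measurable M borel"
    and AI2: "AI2 M X Y"
    and [measurable]: "A \<in> sets borel" "B \<in> sets borel"
  shows "(\<lambda>n. (\<integral>\<omega>. indicator A (X n \<omega>) * indicator B (Y n \<omega>) \<partial>M)
    - (\<integral>\<omega>. indicator A (X n \<omega>) \<partial>M) * (\<integral>\<omega>. indicator B (Y n \<omega>) \<partial>M) :: real) \<longlonglongrightarrow> 0"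
proof -
  interpret prob_space M by fact
  have prob: "measure (distr M N Z) C = (\<integral>\<omega>. indicator C (Z \<omega>) \<partial>M)"
    if [measurable]: "Z \<in> measurable M N" "C \<in> sets N" for N :: "'d measure" and Z C
  proof -
    have "(\<integral>\<omega>. indicator C (Z \<omega>) \<partial>M) = (\<integral>\<omega>. indicator (Z -` C \<inter> space M) \<omega> \<partial>M :: real)"
      by (intro Bochner_Integration.integral_cong) (auto simp: indicator_def)
    then show ?thesis by (simp add: measure_distr)
  qed
  have "measure (distr M (borel \<Otimes>\<^sub>M borel) (\<lambda>\<omega>. (X n \<omega>, Y n \<omega>))) (A \<times> B)
      = (\<integral>\<omega>. indicator A (X n \<omega>) * indicator B (Y n \<omega>) \<partial>M)" for n
    by (subst prob) (auto simp: indicator_times)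
  moreover have "(\<lambda>n. measure (distr M (borel \<Otimes>\<^sub>M borel) (\<lambda>\<omega>. (X n \<omega>, Y n \<omega>))) (A \<times> B)
      - measure (distr M borel (X n)) A * measure (distr M borel (Y n)) B) \<longlonglongrightarrow> 0"
    by (rule tendsto_rabs_zero_cancel) (use AI2 assms(5,6) in \<open>simp add: AI2_def\<close>)
  ultimately show ?thesis by (simp add: prob)
qed

theorem proposition1:
  fixes M :: "'w measure"
    and X :: "nat \<Rightarrow> 'w \<Rightarrow> 'a::polish_space"
    and Y :: "nat \<Rightarrow> 'w \<Rightarrow> 'b::polish_space"
  assumes "prob_space M"
    and "\<And>n. X n \<in> measurable M borel"
    and "\<And>n. Y n \<in> measurable M borel"
    and "AI2 M X Y"
  shows "AI0 M X Y"
  unfolding AI0_def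
proof (intro allI impI)
  fix f :: "'a \<Rightarrow> real" and g :: "'b \<Rightarrow> real"
  assume "bounded (range f)" "uniformly_continuous_on UNIV f"
    and "bounded (range g)" "uniformly_continuous_on UNIV g"
  then have [measurable]: "f \<in> borel_measurable borel" "g \<in> borel_measurable borel"
    by (auto intro!: borel_measurable_continuous_onI uniformly_continuous_imp_continuous)
  from \<open>bounded (range f)\<close> obtain L where L: "\<And>x. \<bar>f x\<bar> \<le> L"
    by (auto simp: bounded_iff)
  from \<open>bounded (range g)\<close> obtain K where K: "\<And>y. \<bar>g y\<bar> \<le> K"
    by (auto simp: bounded_iff)
  note [measurable] = assms(2,3)
  have "(\<lambda>n. (\<integral>\<omega>. f (X n \<omega>) * indicator B (Y n \<omega>) \<partial>M)
      - (\<integral>\<omega>. f (X n \<omega>) \<partial>M) * (\<integral>\<omega>. indicator B (Y n \<omega>) \<partial>M)) \<longlonglongrightarrow> 0"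
    if [measurable]: "B \<in> sets borel" for B
    by (rule covariance_tendsto_zero[OF assms(1,2) _ _ AI2_indicator_covariance[OF assms _ that] _ L,
          where K = 1]) (auto simp: indicator_def)
  then have ind: "(\<lambda>n. (\<integral>\<omega>. indicator B (Y n \<omega>) * f (X n \<omega>) \<partial>M)
      - (\<integral>\<omega>. indicator B (Y n \<omega>) \<partial>M) * (\<integral>\<omega>. f (X n \<omega>) \<partial>M)) \<longlonglongrightarrow> 0"
    if "B \<in> sets borel" for B
    using that by (simp add: mult.commute)
  have "(\<lambda>n. (\<integral>\<omega>. g (Y n \<omega>) * f (X n \<omega>) \<partial>M)
      - (\<integral>\<omega>. g (Y n \<omega>) \<partial>M) * (\<integral>\<omega>. f (X n \<omega>) \<partial>M)) \<longlonglongrightarrow> 0"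
    by (rule covariance_tendsto_zero[OF assms(1,3) _ L ind _ K]; (assumption | measurable))
  then show "(\<lambda>n. (\<integral>\<omega>. f (X n \<omega>) * g (Y n \<omega>) \<partial>M)
      - (\<integral>\<omega>. f (X n \<omega>) \<partial>M) * (\<integral>\<omega>. g (Y n \<omega>) \<partial>M)) \<longlonglongrightarrow> 0"
    by (simp add: mult.commute)
qed

end
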